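(* Let $f:\mathbb{R}^d\to\mathbb{R}$ be convex and differentiable with $L$-Lipschitz gradient, let $h$ be convex on $\mathbb{R}^d$, put $F=f+h$, and let $x^*$ be a minimizer of $F$. Let $(x^k),(z^k)$ be generated by the AAGD iteration described in the context, with parameters $\theta^k$, step size $\gamma>0$, and delays bounded by $\tau$, i.e. $j(k)\in\{k-\tau,\dots,k\}$, $j(k)\ge 0$. (i) (Non-strongly convex case.) Suppose $2\gamma L+3\gamma L(\tau^2+3\tau)^2\le 1$, $\theta^k=\frac{2}{k+2}$, and the first $\tau$ iterations are performed serially (that is, $j(k)=k$ for $0\le k<\tau$, and $j(k)\ge\tau$ for all $k\ge\tau$). Then for every $K\ge 0$ $$F(x^{K+1})-F(x^* )\le (\theta^K)^2\,\frac{1}{2\gamma}\|z^0-x^*\|^2 .$$ (ii) (Strongly convex case.) Suppose $h$ is strongly convex with modulus $\mu$, $0<\mu\le L$, that $\frac52\gamma L+\gamma L(\tau^2+3\tau)^2\le 1$, and that $\theta^k=\theta:=\frac{-\gamma\mu+\sqrt{\gamma^2\mu^2+4\gamma\mu}}{2}$ for all $k$. Then for every $K\ge 0$ $$F(x^{K+1})-F(x^* )\le(1-\theta)^{K+1}\left(F(x^0)-F(x^* )+\left(\frac{\theta^2}{2\gamma}+\frac{\mu\theta}{2}\right)\|z^0-x^*\|^2\right).$$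
   Context: Norms are Euclidean. "$L$-Lipschitz gradient" means $\|\nabla f(x)-\nabla f(y)\|\le L\|x-y\|$ for all $x,y$. The function $h:\mathbb{R}^d\to\mathbb{R}\cup\{+\infty\}$ is proper, lower semicontinuous and convex; it is strongly convex with modulus $\mu$ if $h-\frac{\mu}{2}\|\cdot\|^2$ is convex. Superscripts on $x,z,w,\theta,a$ are iteration indices, except that $(\theta^K)^2$ is the square of $\theta^K$ and, in the strongly convex case, $\theta^2$ and $(1-\theta)^{K+1}$ are powers. Delay model (bounded delay, consistent read): at iteration $k$ the gradient is computed from iterates of an earlier iteration $j(k)$, where $(j(k))_{k\ge0}$ is a given sequence of integers with $\max(0,k-\tau)\le j(k)\le k$, $\tau\ge 0$ an integer. AAGD iteration. Start from $x^0=z^0=0$, with the convention $x^{-1}=x^0$. Put $a^k=\frac{\theta^k(1-\theta^{k-1})}{\theta^{k-1}}$ for $k\ge1$ ($a^0$ may be any number, as it only ever multiplies $x^0-x^{-1}=0$) and $b(l,k)=\prod_{i=l}^{k}a^i$ for $l\le k$. For $k=0,1,2,\dots$: 1. $w^{j(k)}=x^{j(k)}+\Big(\sum_{i=j(k)}^{k}b(j(k),i)\Big)\big(x^{j(k)}-x^{j(k)-1}\big)$; 2. $\delta^k=\arg\min_{\delta}\; h(z^k+\delta)+\langle\nabla f(w^{j(k)}),\delta\rangle+\frac{\theta^k}{2\gamma}\|\delta\|^2$; 3. $z^{k+1}=z^k+\delta^k$; 4. $x^{k+1}=\theta^k z^{k+1}+(1-\theta^k)x^k$. *)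

theory Defs
  imports "HOL-Analysis.Analysis"
begin

section \<open>Extended-valued functions\<close>

text \<open>
  Functions into \<open>\<real> \<union> {+\<infinity>}\<close> are modelled with values in \<^typ>\<open>ereal\<close>; properness excludes
  the value \<open>-\<infinity>\<close>.
\<close>

definition ext_proper :: "('a \<Rightarrow> ereal) \<Rightarrow> bool" where
  "ext_proper h \<longleftrightarrow> (\<forall>x. h x \<noteq> -\<infinity>) \<and> (\<exists>x. h x \<noteq> \<infinity>)"

definition ext_lsc :: "('a::topological_space \<Rightarrow> ereal) \<Rightarrow> bool" where
  "ext_lsc h \<longleftrightarrow> (\<forall>x. h x \<le> Liminf (at x) h)"

text \<open>
  Intended for functions that avoid \<open>-\<infinity>\<close>. At \<open>t = 0\<close> and \<open>t = 1\<close> the inequality is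
  trivially true because \<open>0 * \<infinity> = 0\<close> in \<^typ>\<open>ereal\<close>.
\<close>

definition ext_convex :: "('a::real_vector \<Rightarrow> ereal) \<Rightarrow> bool" where
  "ext_convex h \<longleftrightarrow>
     (\<forall>x y. \<forall>t\<in>{0..1}. h ((1 - t) *\<^sub>R x + t *\<^sub>R y) \<le> ereal (1 - t) * h x + ereal t * h y)"

definition ext_strongly_convex :: "real \<Rightarrow> ('a::real_normed_vector \<Rightarrow> ereal) \<Rightarrow> bool" where
  "ext_strongly_convex \<mu> h \<longleftrightarrow> ext_convex (\<lambda>x. h x - ereal (\<mu> / 2 * (norm x)\<^sup>2))"

definition is_minimizer :: "('a \<Rightarrow> ereal) \<Rightarrow> 'a \<Rightarrow> bool" where
  "is_minimizer F x \<longleftrightarrow> is_arg_min F (\<lambda>_. True) x"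


section \<open>The asynchronous accelerated gradient iteration\<close>

text \<open>
  At \<open>k = 0\<close> truncated subtraction makes this \<open>1 - \<theta> 0\<close> (for nonzero \<open>\<theta> 0\<close>). That value is immaterial: it
  is only ever multiplied by \<open>x 0 - x (0 - 1) = 0\<close>, where truncated subtraction likewise
  realises the convention that the iterate with index \<open>-1\<close> is \<open>x 0\<close>.
\<close>

definition aagd_a :: "(nat \<Rightarrow> real) \<Rightarrow> nat \<Rightarrow> real" where
  "aagd_a \<theta> k = \<theta> k * (1 - \<theta> (k - 1)) / \<theta> (k - 1)"

definition aagd_b :: "(nat \<Rightarrow> real) \<Rightarrow> nat \<Rightarrow> nat \<Rightarrow> real" where
  "aagd_b \<theta> l k = (\<Prod>i=l..k. aagd_a \<theta> i)"

text \<open>The extrapolated point depends on \<open>k\<close> as well as on \<open>j k\<close>, so it is indexed by \<open>k\<close>.\<close>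

definition aagd_w ::
    "(nat \<Rightarrow> real) \<Rightarrow> (nat \<Rightarrow> nat) \<Rightarrow> (nat \<Rightarrow> 'a::real_vector) \<Rightarrow> nat \<Rightarrow> 'a" where
  "aagd_w \<theta> j x k =
     x (j k) + (\<Sum>i=j k..k. aagd_b \<theta> (j k) i) *\<^sub>R (x (j k) - x (j k - 1))"

text \<open>\<open>G\<close> is the gradient of the smooth part.\<close>

definition aagd ::
    "('a::real_inner \<Rightarrow> 'a) \<Rightarrow> ('a \<Rightarrow> ereal) \<Rightarrow> real \<Rightarrow> (nat \<Rightarrow> real) \<Rightarrow> (nat \<Rightarrow> nat) \<Rightarrow>
     (nat \<Rightarrow> 'a) \<Rightarrow> (nat \<Rightarrow> 'a) \<Rightarrow> bool" where
  "aagd G h \<gamma> \<theta> j x z \<longleftrightarrow>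
     x 0 = 0 \<and> z 0 = 0 \<and>
     (\<forall>k. \<exists>\<delta>.
        is_minimizer
          (\<lambda>d. h (z k + d) + ereal (G (aagd_w \<theta> j x k) \<bullet> d + \<theta> k / (2 * \<gamma>) * (norm d)\<^sup>2)) \<delta> \<and>
        z (Suc k) = z k + \<delta> \<and>
        x (Suc k) = \<theta> k *\<^sub>R z (Suc k) + (1 - \<theta> k) *\<^sub>R x k)"

text \<open>Truncated subtraction makes \<open>k - \<tau>\<close> the maximum of \<open>0\<close> and the integer difference.\<close>

definition bounded_delay :: "nat \<Rightarrow> (nat \<Rightarrow> nat) \<Rightarrow> bool" where
  "bounded_delay \<tau> j \<longleftrightarrow> (\<forall>k. k - \<tau> \<le> j k \<and> j k \<le> k)"

definition serial_start :: "nat \<Rightarrow> (nat \<Rightarrow> nat) \<Rightarrow> bool" where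
  "serial_start \<tau> j \<longleftrightarrow> (\<forall>k<\<tau>. j k = k) \<and> (\<forall>k\<ge>\<tau>. \<tau> \<le> j k)"

end

theory Submission
  imports Defs
begin

text \<open>
  Write \<open>w\<close> for the extrapolated point at step \<open>k\<close>. Comparing \<open>f (x (Suc k))\<close>, \<open>f (x k)\<close> and
  \<open>f xs\<close> with the linearization of \<open>f\<close> at \<open>w\<close>, and using optimality of the proximal step, gives the
  usual one-step inequality of accelerated gradient descent, with error
  \<open>L / 2 * (norm (x (Suc k) - w))\<^sup>2\<close> against the gain \<open>(norm (e k))\<^sup>2 / (2 * \<gamma>)\<close>, where
  \<open>e l = \<theta> l *\<^sub>R (z (Suc l) - z l)\<close>. The extrapolation is such that \<open>x (Suc k) - w\<close> is \<open>e k\<close> plus a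
  combination of the \<open>e l\<close>, \<open>j k \<le> l < k\<close>, with coefficients in \<open>[0, k - l + 1]\<close>, whose sum is at
  most \<open>(\<tau>\<^sup>2 + 3 * \<tau>) / 2\<close>. Dividing step \<open>k\<close> by the factor that makes the inequalities telescope
  (\<open>(\<theta> k)\<^sup>2\<close>, respectively \<open>(1 - \<theta>) ^ Suc k\<close>), the gains absorb the errors: within a window of
  length \<open>\<tau>\<close> these factors vary at most by the ratio 4 (thanks to the serial start),
  respectively 4/3.
\<close>

section \<open>First-order bounds for smooth convex functions\<close>

text \<open>The descent lemma. Along the segment from \<open>w\<close> to \<open>u\<close>,
  \<open>f\<close> minus its quadratic model has derivative at most 0, by Cauchy-Schwarz and the
  Lipschitz bound, so comparing the two endpoints suffices and no integral appears.\<close>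

lemma gderiv_lipschitz_upper_bound:
  fixes f :: "'a::real_inner \<Rightarrow> real"
  assumes grad: "\<And>u. GDERIV f u :> G u" and lip: "L-lipschitz_on UNIV G"
  shows "f u \<le> f w + G w \<bullet> (u - w) + L / 2 * (norm (u - w))\<^sup>2"
proof -
  let ?v = "u - w"
  let ?p = "\<lambda>t. f (w + t *\<^sub>R ?v) - t * (G w \<bullet> ?v) - L / 2 * t\<^sup>2 * (norm ?v)\<^sup>2"
  have line: "((\<lambda>t. f (w + t *\<^sub>R ?v)) has_real_derivative G (w + t *\<^sub>R ?v) \<bullet> ?v) (at t)" for t
  proof -
    have "((\<lambda>t. f (w + t *\<^sub>R ?v)) has_derivative (\<lambda>s. (s *\<^sub>R ?v) \<bullet> G (w + t *\<^sub>R ?v))) (at t)"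
      by (rule has_derivative_compose[OF _ grad[unfolded gderiv_def]])
        (auto intro!: derivative_eq_intros)
    then show ?thesis
      by (simp add: has_field_derivative_def inner_commute mult.commute[of _ "inner _ _"])
  qed
  have "?p 1 \<le> ?p 0"
  proof (rule DERIV_nonpos_imp_nonincreasing[where f = ?p and a = 0 and b = 1])
    fix t :: real assume t: "0 \<le> t" "t \<le> 1"
    let ?d = "G (w + t *\<^sub>R ?v) \<bullet> ?v - G w \<bullet> ?v - L * t * (norm ?v)\<^sup>2"
    have "norm (G (w + t *\<^sub>R ?v) - G w) \<le> L * (t * norm ?v)"
      using lipschitz_onD[OF lip, of "w + t *\<^sub>R ?v" w] t by (simp add: dist_norm)
    then have "(G (w + t *\<^sub>R ?v) - G w) \<bullet> ?v \<le> L * (t * norm ?v) * norm ?v"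
      by (meson norm_cauchy_schwarz order_trans mult_right_mono norm_ge_zero)
    then have "?d \<le> 0"
      by (simp add: inner_diff_left power2_eq_square mult.assoc)
    moreover have "(?p has_real_derivative ?d) (at t)"
      by (auto intro!: derivative_eq_intros line)
    ultimately show "\<exists>y. (?p has_real_derivative y) (at t) \<and> y \<le> 0"
      by blast
  qed simp
  then show ?thesis by simp
qed

text \<open>Restricting \<open>f\<close> to the line through \<open>w\<close> and \<open>u\<close>
  reduces this to the tangent inequality for convex functions of one real variable.\<close>

lemma convex_on_gderiv_lower_bound:
  fixes f :: "'a::real_inner \<Rightarrow> real"
  assumes conv: "convex_on UNIV f" and grad: "GDERIV f w :> g"
  shows "f w + g \<bullet> (u - w) \<le> f u"
proof -
  let ?v = "u - w" let ?p = "\<lambda>t::real. f (w + t *\<^sub>R ?v)"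
  have "convex_on UNIV ?p"
  proof (rule convex_onI)
    fix t a b :: real assume "0 < t" "t < 1"
    moreover have "w + ((1 - t) *\<^sub>R a + t *\<^sub>R b) *\<^sub>R ?v
        = (1 - t) *\<^sub>R (w + a *\<^sub>R ?v) + t *\<^sub>R (w + b *\<^sub>R ?v)"
      by (simp add: algebra_simps)
    ultimately show "?p ((1 - t) *\<^sub>R a + t *\<^sub>R b) \<le> (1 - t) * ?p a + t * ?p b"
      using convex_onD[OF conv, of t "w + a *\<^sub>R ?v" "w + b *\<^sub>R ?v"] by simp
  qed simp
  moreover have "(?p has_real_derivative g \<bullet> ?v) (at 0)"
  proof -
    have "(?p has_derivative (\<lambda>s. (s *\<^sub>R ?v) \<bullet> g)) (at 0)"
      by (rule has_derivative_compose[where g = f])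
        (use grad in \<open>auto simp: gderiv_def intro!: derivative_eq_intros\<close>)
    then show ?thesis
      by (simp add: has_field_derivative_def inner_commute mult.commute[of _ "inner _ _"])
  qed
  ultimately have "?p 1 - ?p 0 \<ge> (g \<bullet> ?v) * (1 - 0)"
    by (intro convex_on_imp_above_tangent[where A = UNIV]) auto
  then show ?thesis by simp
qed

section \<open>Strong convexity and the proximal step\<close>

text \<open>Lets the merely convex case be treated as modulus 0.\<close>

lemma ext_strongly_convex_0: "ext_strongly_convex 0 h \<longleftrightarrow> ext_convex h"
  by (simp add: ext_strongly_convex_def flip: zero_ereal_def)

text \<open>The squared norm of a convex combination falls short of the combination of squared norms
  by exactly \<open>t * (1 - t) * (norm (a - b))\<^sup>2\<close>. Finiteness at both endpoints turns
  the bound into a real one.\<close>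

lemma ext_strongly_convexD:
  fixes h :: "'a::real_inner \<Rightarrow> ereal"
  assumes "ext_strongly_convex \<mu> h" and a: "h a = ereal \<alpha>" and b: "h b = ereal \<beta>"
    and t: "0 \<le> t" "t \<le> 1"
  shows "h ((1 - t) *\<^sub>R a + t *\<^sub>R b)
    \<le> ereal ((1 - t) * \<alpha> + t * \<beta> - \<mu> / 2 * (t * (1 - t) * (norm (a - b))\<^sup>2))"
proof -
  let ?c = "(1 - t) *\<^sub>R a + t *\<^sub>R b"
  have le: "h ?c - ereal (\<mu> / 2 * (norm ?c)\<^sup>2)
      \<le> ereal ((1 - t) * (\<alpha> - \<mu> / 2 * (norm a)\<^sup>2) + t * (\<beta> - \<mu> / 2 * (norm b)\<^sup>2))"
    using assms(1) t unfolding ext_strongly_convex_def ext_convex_def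
    by (metis a atLeastAtMost_iff b ereal_minus(1) plus_ereal.simps(1) times_ereal.simps(1))
  have "(norm ?c)\<^sup>2 = (1 - t) * (norm a)\<^sup>2 + t * (norm b)\<^sup>2 - t * (1 - t) * (norm (a - b))\<^sup>2"
    by (simp add: power2_norm_eq_inner inner_add_left inner_add_right inner_diff_left
        inner_diff_right inner_commute[of b a] algebra_simps)
  then have eq: "(1 - t) * (\<alpha> - \<mu> / 2 * (norm a)\<^sup>2) + t * (\<beta> - \<mu> / 2 * (norm b)\<^sup>2) + \<mu> / 2 * (norm ?c)\<^sup>2
     = (1 - t) * \<alpha> + t * \<beta> - \<mu> / 2 * (t * (1 - t) * (norm (a - b))\<^sup>2)"
    by (simp only:) (simp add: field_simps)
  show ?thesis
    using le unfolding eq[symmetric] by (cases "h ?c") auto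
qed

text \<open>The minimizer is compared with points slightly closer to \<open>p\<close>. This replaces
  subgradients of the extended-valued \<open>h\<close>, and also shows that \<open>h\<close> is
  finite at the new point.\<close>

lemma prox_step_inequality:
  fixes h :: "'a::real_inner \<Rightarrow> ereal"
  assumes proper: "ext_proper h" and conv: "ext_strongly_convex \<mu> h"
    and min: "is_minimizer (\<lambda>d. h (z + d) + ereal (g \<bullet> d + c / 2 * (norm d)\<^sup>2)) \<delta>"
    and p: "h p = ereal \<pi>"
  obtains \<eta> where "h (z + \<delta>) = ereal \<eta>"
    and "\<eta> + \<mu> / 2 * (norm (z + \<delta> - p))\<^sup>2
      \<le> \<pi> + g \<bullet> (p - (z + \<delta>))
        + c / 2 * ((norm (z - p))\<^sup>2 - (norm \<delta>)\<^sup>2 - (norm (z + \<delta> - p))\<^sup>2)"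
proof -
  let ?Q = "\<lambda>d. g \<bullet> d + c / 2 * (norm d)\<^sup>2"
  have le: "h (z + \<delta>) + ereal (?Q \<delta>) \<le> h (z + d) + ereal (?Q d)" for d
    using min unfolding is_minimizer_def is_arg_min_def by (auto simp: not_less)
  have "h (z + \<delta>) \<noteq> -\<infinity>" using proper by (auto simp: ext_proper_def)
  moreover have "h (z + \<delta>) \<noteq> \<infinity>" using le[of "p - z"] p by auto
  ultimately obtain \<eta> where \<eta>: "h (z + \<delta>) = ereal \<eta>" by (cases "h (z + \<delta>)") auto
  define v where "v = p - (z + \<delta>)"
  have step: "\<eta> - \<pi> + \<mu> / 2 * (1 - t) * (norm v)\<^sup>2 \<le> g \<bullet> v + c * (\<delta> \<bullet> v) + c / 2 * t * (norm v)\<^sup>2"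
    if t: "t \<in> {0<..<1}" for t
  proof -
    have pt: "(1 - t) *\<^sub>R (z + \<delta>) + t *\<^sub>R p = z + (\<delta> + t *\<^sub>R v)"
      by (simp add: v_def algebra_simps)
    have nv: "norm (z + \<delta> - p) = norm v"
      by (simp add: v_def norm_minus_commute)
    have "h (z + (\<delta> + t *\<^sub>R v)) \<le> ereal ((1 - t) * \<eta> + t * \<pi> - \<mu> / 2 * (t * (1 - t) * (norm v)\<^sup>2))"
      using ext_strongly_convexD[OF conv \<eta> p, of t] t unfolding pt nv by simp
    then have "h (z + \<delta>) + ereal (?Q \<delta>)
        \<le> ereal ((1 - t) * \<eta> + t * \<pi> - \<mu> / 2 * (t * (1 - t) * (norm v)\<^sup>2)) + ereal (?Q (\<delta> + t *\<^sub>R v))"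
      by (meson le add_right_mono order_trans)
    then have *: "\<eta> + ?Q \<delta> \<le> (1 - t) * \<eta> + t * \<pi> - \<mu> / 2 * (t * (1 - t) * (norm v)\<^sup>2) + ?Q (\<delta> + t *\<^sub>R v)"
      by (simp add: \<eta>)
    have Q: "?Q (\<delta> + t *\<^sub>R v) = ?Q \<delta> + t * (g \<bullet> v + c * (\<delta> \<bullet> v) + c / 2 * t * (norm v)\<^sup>2)"
      by (simp add: power2_norm_eq_inner inner_add_left inner_add_right inner_commute[of v \<delta>]
          algebra_simps)
    have "t * (\<eta> - \<pi> + \<mu> / 2 * (1 - t) * (norm v)\<^sup>2)
        \<le> t * (g \<bullet> v + c * (\<delta> \<bullet> v) + c / 2 * t * (norm v)\<^sup>2)"
      using * unfolding Q by (simp add: algebra_simps diff_divide_distrib)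
    then show ?thesis using t by (simp del: distrib_left)
  qed
  \<comment> \<open>As \<open>t\<close> decreases to 0, the modulus term survives in full and the
    second-order term vanishes.\<close>
  have "\<eta> - \<pi> + \<mu> / 2 * (1 - 0) * (norm v)\<^sup>2 \<le> g \<bullet> v + c * (\<delta> \<bullet> v) + c / 2 * 0 * (norm v)\<^sup>2"
  proof (rule tendsto_le[OF trivial_limit_at_right_real])
    show "\<forall>\<^sub>F t in at_right 0. \<eta> - \<pi> + \<mu> / 2 * (1 - t) * (norm v)\<^sup>2
        \<le> g \<bullet> v + c * (\<delta> \<bullet> v) + c / 2 * t * (norm v)\<^sup>2"
      by (rule eventually_mono[OF eventually_at_right_real[of 0 1] step]) auto
  qed (intro tendsto_intros)+
  moreover have "\<delta> \<bullet> v = ((norm (z - p))\<^sup>2 - (norm \<delta>)\<^sup>2 - (norm v)\<^sup>2) / 2"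
  proof -
    have "z - p = - (\<delta> + v)" by (simp add: v_def)
    then show ?thesis
      by (simp add: power2_norm_eq_inner inner_add_left inner_add_right inner_commute[of v \<delta>]
          del: minus_add_distrib add_uminus_conv_diff)
  qed
  then have "c * (\<delta> \<bullet> v) = c / 2 * ((norm (z - p))\<^sup>2 - (norm \<delta>)\<^sup>2 - (norm v)\<^sup>2)"
    by simp
  ultimately have "\<eta> + \<mu> / 2 * (norm v)\<^sup>2
      \<le> \<pi> + g \<bullet> v + c / 2 * ((norm (z - p))\<^sup>2 - (norm \<delta>)\<^sup>2 - (norm v)\<^sup>2)"
    by simp
  then show thesis
    by (intro that[OF \<eta>]) (simp_all add: v_def norm_minus_commute)
qed

section \<open>The extrapolation error caused by delay\<close>

text \<open>Every product starting at \<open>l\<close> contains the factor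
  \<open>aagd_a \<theta> l\<close>; for \<open>i = l\<close> the remaining product is empty, which
  gives the summand 1.\<close>

lemma sum_aagd_b_rec:
  assumes "l \<le> k"
  shows "(\<Sum>i=l..k. aagd_b \<theta> l i) = aagd_a \<theta> l * (1 + (\<Sum>i=Suc l..k. aagd_b \<theta> (Suc l) i))"
proof -
  have "aagd_b \<theta> l i = aagd_a \<theta> l * aagd_b \<theta> (Suc l) i" if "l \<le> i" for i
    using that by (simp add: aagd_b_def prod.atLeast_Suc_atMost)
  moreover have "aagd_b \<theta> (Suc l) l = 1" by (simp add: aagd_b_def)
  ultimately show ?thesis
    using assms by (simp add: sum_distrib_left distrib_left sum.atLeast_Suc_atMost)
qed

text \<open>The coefficient with which the increment of the earlier step \<open>l\<close> enters the
  extrapolation error of step \<open>k\<close>.\<close>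

definition delay_coeff :: "(nat \<Rightarrow> real) \<Rightarrow> nat \<Rightarrow> nat \<Rightarrow> real" where
  "delay_coeff \<theta> k l = 1 + (\<Sum>i=Suc l..k. aagd_b \<theta> (Suc l) i)"

lemma delay_coeff_bounds:
  assumes "\<And>k. 1 \<le> k \<Longrightarrow> 0 \<le> aagd_a \<theta> k \<and> aagd_a \<theta> k \<le> 1" and "l \<le> k"
  shows "0 \<le> delay_coeff \<theta> k l" "delay_coeff \<theta> k l \<le> real (k - l) + 1"
proof -
  have b: "0 \<le> aagd_b \<theta> (Suc l) i \<and> aagd_b \<theta> (Suc l) i \<le> 1" for i
    unfolding aagd_b_def using assms(1) by (auto intro!: prod_nonneg prod_le_1)
  show "0 \<le> delay_coeff \<theta> k l"
    using b by (auto simp: delay_coeff_def intro!: add_nonneg_nonneg sum_nonneg)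
  have "(\<Sum>i=Suc l..k. aagd_b \<theta> (Suc l) i) \<le> (\<Sum>i=Suc l..k. 1)"
    using b by (intro sum_mono) auto
  then show "delay_coeff \<theta> k l \<le> real (k - l) + 1"
    using assms(2) by (simp add: delay_coeff_def)
qed

text \<open>
  Regarded as a function of the delayed index, the extrapolated point changes by a multiple of
  the single increment \<open>\<theta> l *\<^sub>R (z (Suc l) - z l)\<close>, so the delay error telescopes.
\<close>

lemma aagd_w_error:
  fixes x z :: "nat \<Rightarrow> 'a::real_vector"
  assumes rec: "\<And>k. x (Suc k) = \<theta> k *\<^sub>R z (Suc k) + (1 - \<theta> k) *\<^sub>R x k"
    and start: "x 0 = z 0" and \<theta>: "\<And>k. \<theta> k \<noteq> 0" and jk: "j k \<le> k"
  shows "x (Suc k) - aagd_w \<theta> j x k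
    = \<theta> k *\<^sub>R (z (Suc k) - z k) + (\<Sum>l=j k..<k. delay_coeff \<theta> k l *\<^sub>R \<theta> l *\<^sub>R (z (Suc l) - z l))"
proof -
  define dx where "dx l = x l - x (l - 1)" for l
  define w where "w l = x l + (\<Sum>i=l..k. aagd_b \<theta> l i) *\<^sub>R dx l" for l
  \<comment> \<open>The momentum form of the extrapolation agrees with its form in terms of
    \<open>z\<close>. At \<open>l = 0\<close> both sides vanish, by truncated subtraction and the
    common starting point.\<close>
  have ext: "aagd_a \<theta> l *\<^sub>R dx l = \<theta> l *\<^sub>R (z l - x l)" for l
  proof (cases l)
    case 0 then show ?thesis by (simp add: dx_def start)
  next
    case (Suc m)
    have "z l - x l = (1 - \<theta> m) *\<^sub>R (z (Suc m) - x m)"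
      unfolding Suc rec[of m] by (simp add: algebra_simps)
    moreover have "dx l = \<theta> m *\<^sub>R (z (Suc m) - x m)"
      unfolding dx_def Suc diff_Suc_1 rec[of m] by (simp add: algebra_simps)
    ultimately show ?thesis using \<theta>[of m] by (simp add: aagd_a_def Suc)
  qed
  have dx_rec: "dx (Suc l) = aagd_a \<theta> l *\<^sub>R dx l + \<theta> l *\<^sub>R (z (Suc l) - z l)" for l
    unfolding ext by (simp add: dx_def rec algebra_simps)
  have "w (Suc l) - w l = delay_coeff \<theta> k l *\<^sub>R \<theta> l *\<^sub>R (z (Suc l) - z l)" if "l < k" for l
  proof -
    have "w l = x l + delay_coeff \<theta> k l *\<^sub>R aagd_a \<theta> l *\<^sub>R dx l"
      using that by (simp add: w_def sum_aagd_b_rec delay_coeff_def mult.commute)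
    moreover have "w (Suc l) = x l + delay_coeff \<theta> k l *\<^sub>R dx (Suc l)"
      by (simp add: w_def delay_coeff_def dx_def algebra_simps)
    ultimately show ?thesis by (simp add: dx_rec algebra_simps)
  qed
  then have "w k - w (j k) = (\<Sum>l=j k..<k. delay_coeff \<theta> k l *\<^sub>R \<theta> l *\<^sub>R (z (Suc l) - z l))"
    using sum_Suc_diff'[OF jk, of w] by simp
  \<comment> \<open>\<open>w k\<close> is the undelayed extrapolated point
    \<open>x k + \<theta> k *\<^sub>R (z k - x k)\<close>, so the current increment enters with
    coefficient 1.\<close>
  moreover have "x (Suc k) - w k = \<theta> k *\<^sub>R (z (Suc k) - z k)"
    by (simp add: w_def aagd_b_def ext) (simp add: rec algebra_simps)
  moreover have "w (j k) = aagd_w \<theta> j x k"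
    by (simp add: w_def aagd_w_def dx_def)
  ultimately show ?thesis by (metis add_diff_eq diff_add_cancel)
qed

section \<open>Summation of the delay errors\<close>

text \<open>Cauchy-Schwarz after splitting each weight into two square roots.\<close>

lemma weighted_norm_sum_power2_le:
  fixes e :: "'b \<Rightarrow> 'a::real_normed_vector"
  assumes c: "\<And>i. i \<in> I \<Longrightarrow> 0 \<le> c i" and S: "sum c I \<le> S"
  shows "(norm (\<Sum>i\<in>I. c i *\<^sub>R e i))\<^sup>2 \<le> S * (\<Sum>i\<in>I. c i * (norm (e i))\<^sup>2)"
proof -
  have "norm (\<Sum>i\<in>I. c i *\<^sub>R e i) \<le> (\<Sum>i\<in>I. sqrt (c i) * (sqrt (c i) * norm (e i)))"
    by (rule order_trans[OF norm_sum]) (use c in \<open>simp flip: mult.assoc\<close>)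
  then have "(norm (\<Sum>i\<in>I. c i *\<^sub>R e i))\<^sup>2 \<le> (\<Sum>i\<in>I. sqrt (c i) * (sqrt (c i) * norm (e i)))\<^sup>2"
    by (intro power_mono) auto
  also have "\<dots> \<le> (\<Sum>i\<in>I. (sqrt (c i))\<^sup>2) * (\<Sum>i\<in>I. (sqrt (c i) * norm (e i))\<^sup>2)"
    by (rule Cauchy_Schwarz_ineq_sum)
  also have "\<dots> = sum c I * (\<Sum>i\<in>I. c i * (norm (e i))\<^sup>2)"
    using c by (simp add: power_mult_distrib)
  also have "\<dots> \<le> S * (\<Sum>i\<in>I. c i * (norm (e i))\<^sup>2)"
    using c by (intro mult_right_mono S sum_nonneg) auto
  finally show ?thesis .
qed

text \<open>The sum of the largest possible coefficients \<open>m + 1\<close> over the lags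
  \<open>m = 1, ..., \<tau>\<close>; its double is the expression squared in the step size
  conditions.\<close>

definition delay_weight :: "nat \<Rightarrow> real" where
  "delay_weight \<tau> = ((real \<tau>)\<^sup>2 + 3 * real \<tau>) / 2"

lemma delay_weight_nonneg: "0 \<le> delay_weight \<tau>"
  by (simp add: delay_weight_def)

lemma sum_delay_weight: "(\<Sum>m=1..\<tau>. real m + 1) = delay_weight \<tau>"
  by (induction \<tau>) (auto simp: delay_weight_def power2_eq_square field_simps)

text \<open>The current increment is separated from the delayed ones at the cost of a factor 2.
  Replacing \<open>c l\<close> by its bound leaves coefficients that depend on the lag only, which
  prepares the exchange of sums.\<close>

lemma norm_delay_error_le:
  fixes e :: "nat \<Rightarrow> 'a::real_normed_vector"
  assumes c: "\<And>l. l \<in> {j..<k} \<Longrightarrow> 0 \<le> c l \<and> c l \<le> real (k - l) + 1" and j: "k - \<tau> \<le> j"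
  shows "(norm (e k + (\<Sum>l=j..<k. c l *\<^sub>R e l)))\<^sup>2
    \<le> 2 * (norm (e k))\<^sup>2 + 2 * delay_weight \<tau> * (\<Sum>l=j..<k. (real (k - l) + 1) * (norm (e l))\<^sup>2)"
proof -
  let ?s = "\<Sum>l=j..<k. c l *\<^sub>R e l"
  have "sum c {j..<k} \<le> (\<Sum>l=j..<k. real (k - l) + 1)"
    using c by (intro sum_mono) auto
  also have "\<dots> = (\<Sum>m=1..k-j. real m + 1)"
    by (rule sum.reindex_bij_witness[of _ "\<lambda>m. k - m" "\<lambda>l. k - l"]) auto
  also have "\<dots> \<le> (\<Sum>m=1..\<tau>. real m + 1)"
    using j by (intro sum_mono2) auto
  finally have "sum c {j..<k} \<le> delay_weight \<tau>" by (simp only: sum_delay_weight)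
  then have "(norm ?s)\<^sup>2 \<le> delay_weight \<tau> * (\<Sum>l=j..<k. c l * (norm (e l))\<^sup>2)"
    using c by (intro weighted_norm_sum_power2_le) auto
  also have "\<dots> \<le> delay_weight \<tau> * (\<Sum>l=j..<k. (real (k - l) + 1) * (norm (e l))\<^sup>2)"
    using c by (intro mult_left_mono sum_mono mult_right_mono delay_weight_nonneg) auto
  finally have s: "(norm ?s)\<^sup>2 \<le> \<dots>" .
  have "(norm (e k + ?s))\<^sup>2 \<le> (norm (e k) + norm ?s)\<^sup>2"
    by (intro power_mono norm_triangle_ineq) auto
  also have "\<dots> \<le> 2 * (norm (e k))\<^sup>2 + 2 * (norm ?s)\<^sup>2"
    using sum_squares_bound[of "norm (e k)" "norm ?s"] by (simp add: power2_sum)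
  finally show ?thesis using s by simp
qed

text \<open>\<open>W_ratio\<close> moves the weight from the step that suffers an error to the step
  that caused it; exchanging the sums then charges each increment once per lag. This yields a second
  factor \<open>delay_weight \<tau>\<close>.\<close>

lemma weighted_delay_error_sum_le:
  fixes W E D :: "nat \<Rightarrow> real"
  assumes W: "\<And>k. 0 \<le> W k" and E: "\<And>k. 0 \<le> E k"
    and D: "\<And>k. D k \<le> 2 * E k + 2 * delay_weight \<tau> * (\<Sum>l=j k..<k. (real (k - l) + 1) * E l)"
    and j: "bounded_delay \<tau> j" and \<rho>: "0 \<le> \<rho>"
    and W_ratio: "\<And>k l. j k \<le> l \<Longrightarrow> l < k \<Longrightarrow> W k \<le> \<rho> * W l"
  shows "(\<Sum>k\<le>K. W k * D k) \<le> (2 + 2 * \<rho> * (delay_weight \<tau>)\<^sup>2) * (\<Sum>k\<le>K. W k * E k)"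
proof -
  let ?S = "delay_weight \<tau>"
  \<comment> \<open>Zero outside the delay window, so that both indices range over
    \<open>{..K}\<close> and the sums can be swapped.\<close>
  let ?q = "\<lambda>k l. if l < k \<and> k \<le> l + \<tau> then real (k - l) + 1 else 0"
  have "W k * D k \<le> 2 * (W k * E k) + 2 * ?S * \<rho> * (\<Sum>l\<le>K. ?q k l * (W l * E l))" if "k \<le> K" for k
  proof -
    have "W k * (\<Sum>l=j k..<k. (real (k - l) + 1) * E l)
        = (\<Sum>l=j k..<k. (real (k - l) + 1) * (W k * E l))"
      by (simp add: sum_distrib_left mult_ac)
    also have "\<dots> \<le> (\<Sum>l=j k..<k. (real (k - l) + 1) * (\<rho> * W l * E l))"
      using W_ratio E by (intro sum_mono mult_left_mono mult_right_mono) auto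
    also have "\<dots> = (\<Sum>l=j k..<k. \<rho> * (?q k l * (W l * E l)))"
    proof (intro sum.cong refl)
      fix l assume "l \<in> {j k..<k}"
      moreover have "k - \<tau> \<le> j k" using j by (auto simp: bounded_delay_def)
      ultimately have "l < k" "k \<le> l + \<tau>" by auto
      then show "(real (k - l) + 1) * (\<rho> * W l * E l) = \<rho> * (?q k l * (W l * E l))" by simp
    qed
    also have "\<dots> \<le> (\<Sum>l\<le>K. \<rho> * (?q k l * (W l * E l)))"
      using that W E \<rho> by (intro sum_mono2) auto
    finally have "W k * (\<Sum>l=j k..<k. (real (k - l) + 1) * E l)
        \<le> \<rho> * (\<Sum>l\<le>K. ?q k l * (W l * E l))" by (simp add: sum_distrib_left)
    then have "2 * ?S * (W k * (\<Sum>l=j k..<k. (real (k - l) + 1) * E l))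
        \<le> 2 * ?S * (\<rho> * (\<Sum>l\<le>K. ?q k l * (W l * E l)))"
      by (intro mult_left_mono) (auto simp: delay_weight_nonneg)
    moreover have "W k * D k
        \<le> W k * (2 * E k + 2 * ?S * (\<Sum>l=j k..<k. (real (k - l) + 1) * E l))"
      by (intro mult_left_mono D W)
    ultimately show ?thesis by (simp add: algebra_simps)
  qed
  then have "(\<Sum>k\<le>K. W k * D k)
      \<le> (\<Sum>k\<le>K. 2 * (W k * E k) + 2 * ?S * \<rho> * (\<Sum>l\<le>K. ?q k l * (W l * E l)))"
    by (intro sum_mono) auto
  also have "\<dots> = 2 * (\<Sum>k\<le>K. W k * E k) + 2 * ?S * \<rho> * (\<Sum>k\<le>K. \<Sum>l\<le>K. ?q k l * (W l * E l))"
    by (simp add: sum.distrib sum_distrib_left)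
  also have "(\<Sum>k\<le>K. \<Sum>l\<le>K. ?q k l * (W l * E l)) = (\<Sum>l\<le>K. (\<Sum>k\<le>K. ?q k l) * (W l * E l))"
    by (subst sum.swap) (simp add: sum_distrib_right)
  also have "2 * (\<Sum>k\<le>K. W k * E k) + 2 * ?S * \<rho> * \<dots>
      \<le> 2 * (\<Sum>k\<le>K. W k * E k) + 2 * ?S * \<rho> * (\<Sum>l\<le>K. ?S * (W l * E l))"
  proof (intro add_left_mono mult_left_mono sum_mono mult_right_mono)
    fix l
    \<comment> \<open>For fixed \<open>l\<close>, each lag from 1 to \<tau> is attained by at most
      one later step \<open>k\<close>.\<close>
    have "(\<Sum>k\<le>K. ?q k l) \<le> (\<Sum>k=l+1..l+\<tau>. real (k - l) + 1)"
      by (subst sum.If_cases) (auto intro!: sum_mono2)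
    also have "\<dots> = (\<Sum>m=1..\<tau>. real m + 1)"
      by (rule sum.reindex_bij_witness[of _ "\<lambda>m. m + l" "\<lambda>k. k - l"]) auto
    finally show "(\<Sum>k\<le>K. ?q k l) \<le> ?S" by (simp only: sum_delay_weight)
  qed (use W E \<rho> delay_weight_nonneg in auto)
  also have "\<dots> = (2 + 2 * \<rho> * ?S\<^sup>2) * (\<Sum>k\<le>K. W k * E k)"
    by (simp only: sum_distrib_left[symmetric]) (simp add: power2_eq_square algebra_simps)
  finally show ?thesis .
qed

text \<open>Summing the hypothesis \<open>u\<close> leaves a multiple of the total weighted gain,
  and \<open>step_size\<close> says that this multiple is not positive. The weights and \<rho> stay
  abstract because the two cases choose them differently.\<close>

lemma delayed_energy_le:
  fixes u W E D :: "nat \<Rightarrow> real"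
  assumes W: "\<And>k. 0 \<le> W k" and E: "\<And>k. 0 \<le> E k"
    and D: "\<And>k. D k \<le> 2 * E k + 2 * delay_weight \<tau> * (\<Sum>l=j k..<k. (real (k - l) + 1) * E l)"
    and j: "bounded_delay \<tau> j" and \<rho>: "0 \<le> \<rho>"
    and W_ratio: "\<And>k l. j k \<le> l \<Longrightarrow> l < k \<Longrightarrow> W k \<le> \<rho> * W l"
    and L: "0 \<le> L" and \<gamma>: "0 < \<gamma>"
    and step_size: "\<gamma> * L * (2 + 2 * \<rho> * (delay_weight \<tau>)\<^sup>2) \<le> 1"
    and u: "\<And>k. u (Suc k) \<le> u k + W k * (L / 2 * D k - E k / (2 * \<gamma>))"
  shows "u (Suc K) \<le> u 0"
proof -
  let ?T = "2 + 2 * \<rho> * (delay_weight \<tau>)\<^sup>2" and ?WE = "\<Sum>k\<le>K. W k * E k"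
  have "u (Suc K) \<le> u 0 + (\<Sum>k\<le>K. W k * (L / 2 * D k - E k / (2 * \<gamma>)))"
  proof (induction K)
    case 0 then show ?case using u[of 0] by simp
  next
    case (Suc K) then show ?case using u[of "Suc K"] by simp
  qed
  also have "(\<Sum>k\<le>K. W k * (L / 2 * D k - E k / (2 * \<gamma>)))
      = L / 2 * (\<Sum>k\<le>K. W k * D k) - 1 / (2 * \<gamma>) * ?WE"
    by (simp add: sum_distrib_left sum_subtractf[symmetric] algebra_simps)
  also have "\<dots> \<le> L / 2 * (?T * ?WE) - 1 / (2 * \<gamma>) * ?WE"
    using weighted_delay_error_sum_le[OF W E D j \<rho> W_ratio, where K = K] L
    by (intro diff_right_mono mult_left_mono) auto
  also have "\<dots> = (\<gamma> * L * ?T - 1) / (2 * \<gamma>) * ?WE"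
    using \<gamma> by (simp add: field_simps)
  also have "\<dots> \<le> 0"
    using step_size \<gamma> W E
    by (intro mult_nonpos_nonneg divide_nonpos_pos sum_nonneg mult_nonneg_nonneg) auto
  finally show ?thesis by simp
qed

section \<open>The one-step inequality for the iteration\<close>

text \<open>A common setting for both cases. The bounds on \<theta> and \<open>aagd_a\<close> are
  assumed here because they hold for different reasons in each case.\<close>

locale aagd_run =
  fixes f :: "'a::euclidean_space \<Rightarrow> real" and G :: "'a \<Rightarrow> 'a" and h :: "'a \<Rightarrow> ereal" and xs :: 'a
    and x z :: "nat \<Rightarrow> 'a" and \<theta> :: "nat \<Rightarrow> real" and j :: "nat \<Rightarrow> nat"
    and L \<gamma> \<mu> :: real and \<tau> :: nat
  assumes f_convex: "convex_on UNIV f"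
    and f_gradient: "\<And>u. GDERIV f u :> G u"
    and G_lipschitz: "L-lipschitz_on UNIV G"
    and h_proper: "ext_proper h"
    and h_strongly_convex: "ext_strongly_convex \<mu> h" and mu_nonneg: "0 \<le> \<mu>"
    and xs_min: "is_minimizer (\<lambda>u. ereal (f u) + h u) xs"
    and gamma_pos: "0 < \<gamma>"
    and delay: "bounded_delay \<tau> j"
    and iteration: "aagd G h \<gamma> \<theta> j x z"
    and theta_pos: "\<And>k. 0 < \<theta> k" and theta_le: "\<And>k. \<theta> k \<le> 1"
    and a_bounds: "\<And>k. 1 \<le> k \<Longrightarrow> 0 \<le> aagd_a \<theta> k \<and> aagd_a \<theta> k \<le> 1"
begin

text \<open>Meaningful only where \<open>h\<close> is finite, since \<open>real_of_ereal\<close> sends \<open>\<infinity>\<close> to \<open>0\<close>.\<close>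

definition gap :: "'a \<Rightarrow> real" where
  "gap u = f u + real_of_ereal (h u) - (f xs + real_of_ereal (h xs))"

definition sqdist :: "nat \<Rightarrow> real" where
  "sqdist k = (norm (z k - xs))\<^sup>2"

definition incr :: "nat \<Rightarrow> real" where
  "incr k = (norm (\<theta> k *\<^sub>R (z (Suc k) - z k)))\<^sup>2"

definition err :: "nat \<Rightarrow> real" where
  "err k = (norm (x (Suc k) - aagd_w \<theta> j x k))\<^sup>2"

lemma L_nonneg: "0 \<le> L"
  using G_lipschitz by (rule lipschitz_on_nonneg)

lemma start: "x 0 = 0" "z 0 = 0"
  using iteration by (auto simp: aagd_def)

lemma x_rec: "x (Suc k) = \<theta> k *\<^sub>R z (Suc k) + (1 - \<theta> k) *\<^sub>R x k"
  using iteration by (auto simp: aagd_def)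

lemma h_not_MInf: "h u \<noteq> -\<infinity>"
  using h_proper by (auto simp: ext_proper_def)

lemma minimizer_le: "ereal (f xs) + h xs \<le> ereal (f u) + h u"
  using xs_min by (auto simp: is_minimizer_def is_arg_min_def not_less)

lemma h_xs_finite: "h xs = ereal (real_of_ereal (h xs))"
proof -
  obtain p where "h p \<noteq> \<infinity>" using h_proper by (auto simp: ext_proper_def)
  then have "h xs \<noteq> \<infinity>" using minimizer_le[of p] by (cases "h p") auto
  then show ?thesis using h_not_MInf[of xs] by (cases "h xs") auto
qed

text \<open>Passes from the extended-real differences of the theorem to real arithmetic.\<close>

lemma ereal_gap:
  assumes "h u \<noteq> \<infinity>"
  shows "(ereal (f u) + h u) - (ereal (f xs) + h xs) = ereal (gap u)"
  using assms h_xs_finite h_not_MInf[of u]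
  by (cases "h u"; cases "h xs") (auto simp: gap_def)

lemma gap_nonneg:
  assumes "h u \<noteq> \<infinity>" shows "0 \<le> gap u"
  using assms minimizer_le[of u] h_xs_finite h_not_MInf[of u]
  by (cases "h u"; cases "h xs") (auto simp: gap_def)

lemma err_le:
  "err k \<le> 2 * incr k + 2 * delay_weight \<tau> * (\<Sum>l=j k..<k. (real (k - l) + 1) * incr l)"
proof -
  have j: "k - \<tau> \<le> j k" "j k \<le> k" using delay by (auto simp: bounded_delay_def)
  have "x (Suc k) - aagd_w \<theta> j x k
    = \<theta> k *\<^sub>R (z (Suc k) - z k) + (\<Sum>l=j k..<k. delay_coeff \<theta> k l *\<^sub>R \<theta> l *\<^sub>R (z (Suc l) - z l))"
    by (rule aagd_w_error) (use x_rec start j theta_pos in \<open>auto simp: less_imp_neq[symmetric]\<close>)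
  then show ?thesis
    unfolding err_def incr_def
    using norm_delay_error_le[OF _ j(1), of "delay_coeff \<theta> k" "\<lambda>l. \<theta> l *\<^sub>R (z (Suc l) - z l)"]
      delay_coeff_bounds[OF a_bounds] by simp
qed

text \<open>\<open>fin\<close> allows \<open>h (x k)\<close> to be infinite when
  \<open>\<theta> k = 1\<close>, since \<open>x k\<close> then has coefficient 0. This covers the
  first step of the convex case.\<close>

lemma gap_step:
  assumes fin: "\<theta> k = 1 \<or> h (x k) \<noteq> \<infinity>"
  shows "h (x (Suc k)) \<noteq> \<infinity>"
    and "gap (x (Suc k)) \<le> (1 - \<theta> k) * gap (x k) + (\<theta> k)\<^sup>2 / (2 * \<gamma>) * sqdist k
      - ((\<theta> k)\<^sup>2 / (2 * \<gamma>) + \<mu> * \<theta> k / 2) * sqdist (Suc k)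
      + (L / 2 * err k - incr k / (2 * \<gamma>))"
proof -
  let ?t = "\<theta> k" and ?w = "aagd_w \<theta> j x k" and ?H = "\<lambda>u. real_of_ereal (h u)"
  have t: "0 < ?t" "?t \<le> 1" using theta_pos theta_le by auto
  obtain \<delta> where z_rec: "z (Suc k) = z k + \<delta>"
    and min: "is_minimizer
      (\<lambda>d. h (z k + d) + ereal (G ?w \<bullet> d + (?t / \<gamma>) / 2 * (norm d)\<^sup>2)) \<delta>"
    using iteration by (auto simp: aagd_def mult.commute)
  obtain \<eta> where \<eta>: "h (z (Suc k)) = ereal \<eta>"
    and prox: "\<eta> + \<mu> / 2 * sqdist (Suc k) \<le> ?H xs + G ?w \<bullet> (xs - z (Suc k))
        + (?t / \<gamma>) / 2 * (sqdist k - (norm \<delta>)\<^sup>2 - sqdist (Suc k))"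
    unfolding sqdist_def z_rec
    by (rule prox_step_inequality[OF h_proper h_strongly_convex min h_xs_finite])
  have hx: "h (x (Suc k)) \<le> ereal ((1 - ?t) * ?H (x k) + ?t * \<eta>)"
  proof (cases "?t = 1")
    case True then show ?thesis using \<eta> x_rec[of k] by simp
  next
    case False
    then have "h (x k) = ereal (?H (x k))"
      using fin h_not_MInf[of "x k"] by (cases "h (x k)") auto
    from ext_strongly_convexD[OF h_strongly_convex this \<eta>, of ?t] t
    have "h (x (Suc k)) \<le> ereal ((1 - ?t) * ?H (x k) + ?t * \<eta>
        - \<mu> / 2 * (?t * (1 - ?t) * (norm (x k - z (Suc k)))\<^sup>2))"
      by (simp add: x_rec add.commute)
    \<comment> \<open>The strong convexity gain is dropped here; \<mu> reaches the conclusion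
      through the proximal inequality.\<close>
    also have "\<dots> \<le> ereal ((1 - ?t) * ?H (x k) + ?t * \<eta>)"
      using t mu_nonneg by simp
    finally show ?thesis .
  qed
  then show "h (x (Suc k)) \<noteq> \<infinity>" by auto
  have Hx: "?H (x (Suc k)) \<le> (1 - ?t) * ?H (x k) + ?t * \<eta>"
    using hx h_not_MInf[of "x (Suc k)"] by (cases "h (x (Suc k))") auto
  have f_up: "f (x (Suc k)) \<le> f ?w + G ?w \<bullet> (x (Suc k) - ?w) + L / 2 * err k"
    unfolding err_def by (rule gderiv_lipschitz_upper_bound[OF f_gradient G_lipschitz])
  have "(1 - ?t) * (f ?w + G ?w \<bullet> (x k - ?w)) + ?t * (f ?w + G ?w \<bullet> (xs - ?w))
      \<le> (1 - ?t) * f (x k) + ?t * f xs"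
    using t by (intro add_mono mult_left_mono convex_on_gderiv_lower_bound f_convex f_gradient) auto
  moreover have "f ?w + G ?w \<bullet> (x (Suc k) - ?w)
      = (1 - ?t) * (f ?w + G ?w \<bullet> (x k - ?w)) + ?t * (f ?w + G ?w \<bullet> (xs - ?w))
        + ?t * (G ?w \<bullet> (z (Suc k) - xs))"
    by (simp add: x_rec inner_diff_right inner_add_right algebra_simps)
  ultimately have f_x: "f (x (Suc k)) \<le> (1 - ?t) * f (x k) + ?t * f xs
      + ?t * (G ?w \<bullet> (z (Suc k) - xs)) + L / 2 * err k"
    using f_up by linarith
  \<comment> \<open>With the factor \<open>?t\<close>, the gradient term cancels the one left over
    in \<open>f_x\<close>.\<close>
  have "?t * (\<eta> + \<mu> / 2 * sqdist (Suc k)) \<le> ?t * (?H xs + G ?w \<bullet> (xs - z (Suc k))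
        + (?t / \<gamma>) / 2 * (sqdist k - (norm \<delta>)\<^sup>2 - sqdist (Suc k)))"
    using t prox by (intro mult_left_mono) auto
  also have "\<dots> = ?t * ?H xs - ?t * (G ?w \<bullet> (z (Suc k) - xs))
        + ?t\<^sup>2 / (2 * \<gamma>) * (sqdist k - sqdist (Suc k)) - incr k / (2 * \<gamma>)"
    using gamma_pos
    by (simp add: incr_def z_rec inner_diff_right power_mult_distrib power2_eq_square field_simps)
  finally show "gap (x (Suc k)) \<le> (1 - ?t) * gap (x k) + ?t\<^sup>2 / (2 * \<gamma>) * sqdist k
      - (?t\<^sup>2 / (2 * \<gamma>) + \<mu> * ?t / 2) * sqdist (Suc k) + (L / 2 * err k - incr k / (2 * \<gamma>))"
    using Hx f_x unfolding gap_def
    by (simp add: algebra_simps add_divide_distrib diff_divide_distrib)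
qed

lemma energy_le:
  assumes W: "\<And>k. 0 \<le> W k" and \<rho>: "0 \<le> \<rho>"
    and W_ratio: "\<And>k l. j k \<le> l \<Longrightarrow> l < k \<Longrightarrow> W k \<le> \<rho> * W l"
    and step_size: "\<gamma> * L * (2 + 2 * \<rho> * (delay_weight \<tau>)\<^sup>2) \<le> 1"
    and u: "\<And>k. u (Suc k) \<le> u k + W k * (L / 2 * err k - incr k / (2 * \<gamma>))"
  shows "u (Suc K) \<le> u 0"
  by (rule delayed_energy_le[OF W _ err_le delay \<rho> W_ratio L_nonneg gamma_pos step_size u])
    (auto simp: incr_def)

end

section \<open>The convergence rates in the two cases\<close>

lemma aagd_convex_rate:
  fixes f :: "'a::euclidean_space \<Rightarrow> real" and \<tau> :: nat
  assumes run: "aagd_run f G h xs x z \<theta> j L \<gamma> 0 \<tau>"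
    and step_size: "2 * \<gamma> * L + 3 * \<gamma> * L * ((real \<tau>)\<^sup>2 + 3 * real \<tau>)\<^sup>2 \<le> 1"
    and \<theta>: "\<And>k. \<theta> k = 2 / (real k + 2)" and serial: "serial_start \<tau> j"
  shows "(ereal (f (x (Suc K))) + h (x (Suc K))) - (ereal (f xs) + h xs)
    \<le> ereal ((\<theta> K)\<^sup>2 * (1 / (2 * \<gamma>)) * (norm (z 0 - xs))\<^sup>2)"
proof -
  interpret aagd_run f G h xs x z \<theta> j L \<gamma> 0 \<tau> by (fact run)
  \<comment> \<open>The induction starts from \<open>\<theta> 0 = 1\<close>, so nothing is claimed
    about \<open>h (x 0)\<close>.\<close>
  have fin: "h (x (Suc k)) \<noteq> \<infinity>" for k
    by (induction k) (auto intro!: gap_step(1) simp: \<theta>)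
  define W where "W k = 1 / (\<theta> k)\<^sup>2" for k
  \<comment> \<open>The gap at \<open>x (Suc m)\<close> carries the weight of the step that produced
    it. No step produced \<open>x 0\<close>, where \<open>gap\<close> may be meaningless.\<close>
  define u where "u k = (case k of 0 \<Rightarrow> 0 | Suc m \<Rightarrow> W m * gap (x k)) + sqdist k / (2 * \<gamma>)" for k
  have W_pos: "0 < W k" for k using theta_pos[of k] by (simp add: W_def)
  have u_step: "u (Suc k) \<le> u k + W k * (L / 2 * err k - incr k / (2 * \<gamma>))" for k
  proof -
    have prev: "W k * ((1 - \<theta> k) * gap (x k)) \<le> u k - sqdist k / (2 * \<gamma>)"
    proof (cases k)
      case 0 then show ?thesis by (simp add: u_def \<theta>)
    next
      case (Suc m)
      \<comment> \<open>With \<open>k = m + 1\<close> this is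
        \<open>k * (k + 2) \<le> (k + 1)\<^sup>2\<close>, divided by 4.\<close>
      have "W k * (1 - \<theta> k) \<le> W m"
        unfolding W_def \<theta> Suc by (simp add: field_simps power2_eq_square)
      then have "W k * (1 - \<theta> k) * gap (x k) \<le> W m * gap (x k)"
        using gap_nonneg[OF fin] Suc by (intro mult_right_mono) auto
      then show ?thesis by (simp add: u_def Suc mult.assoc)
    qed
    have Wt: "W k * (\<theta> k)\<^sup>2 = 1" using theta_pos[of k] by (simp add: W_def)
    have "W k * gap (x (Suc k)) \<le> W k * ((1 - \<theta> k) * gap (x k) + (\<theta> k)\<^sup>2 / (2 * \<gamma>) * sqdist k
        - ((\<theta> k)\<^sup>2 / (2 * \<gamma>) + 0 * \<theta> k / 2) * sqdist (Suc k)
        + (L / 2 * err k - incr k / (2 * \<gamma>)))"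
    proof (intro mult_left_mono gap_step)
      show "\<theta> k = 1 \<or> h (x k) \<noteq> \<infinity>" by (cases k) (simp_all add: \<theta> fin)
    qed (use W_pos[of k] in simp)
    also have "\<dots> = W k * ((1 - \<theta> k) * gap (x k)) + (W k * (\<theta> k)\<^sup>2) * sqdist k / (2 * \<gamma>)
        - (W k * (\<theta> k)\<^sup>2) * sqdist (Suc k) / (2 * \<gamma>)
        + W k * (L / 2 * err k - incr k / (2 * \<gamma>))"
      by (simp add: algebra_simps)
    finally show ?thesis using prev unfolding Wt by (simp add: u_def)
  qed
  have "u (Suc K) \<le> u 0"
  proof (rule energy_le[OF _ _ _ _ u_step])
    \<comment> \<open>A genuinely delayed step has \<open>\<tau> \<le> k\<close>, hence
      \<open>\<tau> \<le> j k \<le> l\<close> by the serial start. So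
      \<open>k \<le> l + \<tau> \<le> 2 * l\<close>, and squaring
      \<open>k + 2 \<le> 2 * (l + 2)\<close> gives the 4.\<close>
    show "W k \<le> 4 * W l" if "j k \<le> l" "l < k" for k l
    proof -
      have "\<tau> \<le> k" using serial that by (force simp: serial_start_def)
      then have "\<tau> \<le> l" using serial that by (force simp: serial_start_def)
      moreover have "k - \<tau> \<le> j k" using delay by (auto simp: bounded_delay_def)
      then have "k \<le> l + \<tau>" using that by linarith
      ultimately have "k \<le> l + l" by (meson add_left_mono le_trans)
      then have "k + 2 \<le> 2 * (l + 2)" by simp
      then have "real (k + 2) \<le> real (2 * (l + 2))" by (simp only: of_nat_le_iff)
      then have "real k + 2 \<le> 2 * (real l + 2)" by simp
      then have "(real k + 2)\<^sup>2 \<le> (2 * (real l + 2))\<^sup>2" by (rule power_mono) simp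
      also have "\<dots> = 4 * (real l + 2)\<^sup>2" by (simp only: power_mult_distrib) simp
      finally show ?thesis by (simp add: W_def \<theta> power_divide)
    qed
    have "\<gamma> * L * (2 + 2 * 4 * (delay_weight \<tau>)\<^sup>2)
        \<le> \<gamma> * L * (2 + 3 * ((real \<tau>)\<^sup>2 + 3 * real \<tau>)\<^sup>2)"
      using gamma_pos L_nonneg
      by (intro mult_left_mono) (auto simp: delay_weight_def power_divide)
    then show "\<gamma> * L * (2 + 2 * 4 * (delay_weight \<tau>)\<^sup>2) \<le> 1"
      using step_size by (simp add: algebra_simps)
  qed (use W_pos in \<open>auto intro: less_imp_le\<close>)
  moreover have "0 \<le> sqdist (Suc K) / (2 * \<gamma>)"
    using gamma_pos by (simp add: sqdist_def)
  ultimately have "W K * gap (x (Suc K)) \<le> sqdist 0 / (2 * \<gamma>)" by (simp add: u_def)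
  then have "gap (x (Suc K)) \<le> (\<theta> K)\<^sup>2 * (1 / (2 * \<gamma>)) * sqdist 0"
    using theta_pos[of K] by (simp add: W_def field_simps)
  then show ?thesis by (simp add: ereal_gap[OF fin] sqdist_def)
qed

text \<open>\<open>t\<close> is the positive root of \<open>t\<^sup>2 + q * t - q = 0\<close>; it is
  used with \<open>q = \<gamma> * \<mu>\<close>.\<close>

lemma strongly_convex_theta:
  fixes q :: real
  assumes "0 < q" and t: "t = (- q + sqrt (q\<^sup>2 + 4 * q)) / 2"
  shows "0 < t" "t < 1" "t\<^sup>2 = q * (1 - t)"
proof -
  let ?s = "sqrt (q\<^sup>2 + 4 * q)"
  have s: "?s\<^sup>2 = q\<^sup>2 + 4 * q" using assms(1) by simp
  have "q < ?s" using assms(1) by (intro real_less_rsqrt) simp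
  then show "0 < t" using t by simp
  have "?s < q + 2" using assms(1) by (intro real_less_lsqrt) (auto simp: power2_sum)
  then show "t < 1" using t by simp
  show "t\<^sup>2 = q * (1 - t)"
    using s unfolding t by (simp add: power_divide power2_sum power2_diff field_simps power2_eq_square)
qed

lemma aagd_strongly_convex_rate:
  fixes f :: "'a::euclidean_space \<Rightarrow> real" and \<tau> :: nat
  assumes run: "aagd_run f G h xs x z \<theta> j L \<gamma> \<mu> \<tau>"
    and \<mu>: "0 < \<mu>" "\<mu> \<le> L"
    and step_size: "5 / 2 * \<gamma> * L + \<gamma> * L * ((real \<tau>)\<^sup>2 + 3 * real \<tau>)\<^sup>2 \<le> 1"
    and \<theta>: "\<And>k. \<theta> k = t" and t_eq: "t\<^sup>2 = \<gamma> * \<mu> * (1 - t)" and t: "0 < t" "t < 1"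
  shows "(ereal (f (x (Suc K))) + h (x (Suc K))) - (ereal (f xs) + h xs)
    \<le> ereal ((1 - t) ^ Suc K) * ((ereal (f (x 0)) + h (x 0)) - (ereal (f xs) + h xs)
        + ereal ((t\<^sup>2 / (2 * \<gamma>) + \<mu> * t / 2) * (norm (z 0 - xs))\<^sup>2))"
proof (cases "h (x 0) = \<infinity>")
  \<comment> \<open>The right-hand side is infinite, because \<open>1 - t\<close> is positive and
    \<open>h xs\<close> is finite.\<close>
  case True
  interpret aagd_run f G h xs x z \<theta> j L \<gamma> \<mu> \<tau> by (fact run)
  show ?thesis
    using t by (subst (2) h_xs_finite) (simp add: True)
next
  case fin0: False
  interpret aagd_run f G h xs x z \<theta> j L \<gamma> \<mu> \<tau> by (fact run)
  have fin: "h (x k) \<noteq> \<infinity>" for k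
    by (induction k) (auto intro!: gap_step(1) simp: fin0)
  define c where "c = t\<^sup>2 / (2 * \<gamma>) + \<mu> * t / 2"
  \<comment> \<open>The quadratic equation for \<open>t\<close> makes the coefficient of the old
    distance exactly \<open>1 - t\<close> times that of the new one, so gap and distance contract
    together.\<close>
  have c: "t\<^sup>2 / (2 * \<gamma>) = (1 - t) * c"
  proof -
    have "t\<^sup>2 / (2 * \<gamma>) * t = (1 - t) * (\<mu> * t / 2)"
      unfolding t_eq using gamma_pos by (simp add: field_simps)
    moreover have "(1 - t) * c = t\<^sup>2 / (2 * \<gamma>) - t\<^sup>2 / (2 * \<gamma>) * t + (1 - t) * (\<mu> * t / 2)"
      by (simp only: c_def distrib_left left_diff_distrib mult_1 mult.commute)
    ultimately show ?thesis by simp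
  qed
  define W where "W k = 1 / (1 - t) ^ Suc k" for k
  define u where "u k = (gap (x k) + c * sqdist k) / (1 - t) ^ k" for k
  have W_pos: "0 < W k" for k using t by (simp add: W_def)
  have u_step: "u (Suc k) \<le> u k + W k * (L / 2 * err k - incr k / (2 * \<gamma>))" for k
  proof -
    have "gap (x (Suc k)) + c * sqdist (Suc k)
        \<le> (1 - t) * (gap (x k) + c * sqdist k) + (L / 2 * err k - incr k / (2 * \<gamma>))"
      using gap_step(2)[of k] fin[of k] unfolding \<theta>[of k] c_def[symmetric]
      unfolding c by (simp add: algebra_simps)
    then have "W k * (gap (x (Suc k)) + c * sqdist (Suc k))
        \<le> W k * ((1 - t) * (gap (x k) + c * sqdist k) + (L / 2 * err k - incr k / (2 * \<gamma>)))"
      using W_pos[of k] by (intro mult_left_mono) auto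
    also have "\<dots> = W k * (1 - t) * (gap (x k) + c * sqdist k)
        + W k * (L / 2 * err k - incr k / (2 * \<gamma>))"
      by (simp add: distrib_left mult.assoc)
    also have "W k * (1 - t) = 1 / (1 - t) ^ k" using t by (simp add: W_def)
    finally show ?thesis by (simp add: u_def W_def)
  qed
  have "0 \<le> \<gamma> * L" using gamma_pos L_nonneg by simp
  have "u (Suc K) \<le> u 0"
  proof (rule energy_le[OF _ _ _ _ u_step])
    have "t\<^sup>2 \<le> \<gamma> * L"
    proof -
      have "t\<^sup>2 \<le> \<gamma> * \<mu> * 1"
        unfolding t_eq using t \<mu> gamma_pos by (intro mult_left_mono) auto
      also have "\<dots> \<le> \<gamma> * L" using \<mu> gamma_pos by simp
      finally show ?thesis .
    qed
    \<comment> \<open>Since \<tau> is a natural number,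
      \<open>4 * \<tau> \<le> \<tau>\<^sup>2 + 3 * \<tau>\<close>, so the step size condition bounds
      \<open>\<tau> * t\<close> by 1/4. Bernoulli's inequality then gives
      \<open>(1 - t) ^ \<tau> \<ge> 3 / 4\<close>, the source of the ratio 4/3.\<close>
    have "(4 * (real \<tau> * t))\<^sup>2 \<le> 1"
    proof -
      have "real \<tau> \<le> (real \<tau>)\<^sup>2" by (cases \<tau>) (auto simp: power2_eq_square)
      then have "(4 * real \<tau>)\<^sup>2 \<le> ((real \<tau>)\<^sup>2 + 3 * real \<tau>)\<^sup>2" by (intro power_mono) auto
      then have "t\<^sup>2 * (4 * real \<tau>)\<^sup>2 \<le> \<gamma> * L * ((real \<tau>)\<^sup>2 + 3 * real \<tau>)\<^sup>2"
        using \<open>t\<^sup>2 \<le> \<gamma> * L\<close> \<open>0 \<le> \<gamma> * L\<close> by (intro mult_mono) auto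
      also have "\<dots> \<le> 1" using step_size \<open>0 \<le> \<gamma> * L\<close> by linarith
      finally show ?thesis by (simp add: power_mult_distrib mult_ac)
    qed
    then have "4 * (real \<tau> * t) \<le> 1"
      by (subst (asm) abs_square_le_1) linarith
    moreover have "1 + real \<tau> * (- t) \<le> (1 + - t) ^ \<tau>"
      using t by (intro Bernoulli_inequality) auto
    ultimately have pow: "3 / 4 \<le> (1 - t) ^ \<tau>" by simp
    show "W k \<le> 4 / 3 * W l" if "j k \<le> l" "l < k" for k l
    proof -
      have "k - \<tau> \<le> j k" using delay by (auto simp: bounded_delay_def)
      then have "k - l \<le> \<tau>" using that by linarith
      then have "(1 - t) ^ \<tau> \<le> (1 - t) ^ (k - l)" using t by (intro power_decreasing) auto
      then have "3 / 4 * W k \<le> (1 - t) ^ (k - l) * W k"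
        using pow W_pos[of k] by (intro mult_right_mono) auto
      also have "(1 - t) ^ (k - l) * W k = W l"
      proof -
        have "(1 - t) ^ Suc k = (1 - t) ^ (k - l) * (1 - t) ^ Suc l"
          using that by (simp flip: power_add)
        then show ?thesis using t by (simp add: W_def)
      qed
      finally show ?thesis by simp
    qed
    have "\<gamma> * L * (2 + 2 * (4 / 3) * (delay_weight \<tau>)\<^sup>2)
        \<le> \<gamma> * L * (5 / 2 + ((real \<tau>)\<^sup>2 + 3 * real \<tau>)\<^sup>2)"
    proof (rule mult_left_mono)
      have "2 * (4 / 3) * (delay_weight \<tau>)\<^sup>2 = 2 / 3 * ((real \<tau>)\<^sup>2 + 3 * real \<tau>)\<^sup>2"
        by (simp add: delay_weight_def power_divide)
      then show "2 + 2 * (4 / 3) * (delay_weight \<tau>)\<^sup>2 \<le> 5 / 2 + ((real \<tau>)\<^sup>2 + 3 * real \<tau>)\<^sup>2"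
        using zero_le_power2[of "(real \<tau>)\<^sup>2 + 3 * real \<tau>"] by linarith
    qed fact
    then show "\<gamma> * L * (2 + 2 * (4 / 3) * (delay_weight \<tau>)\<^sup>2) \<le> 1"
      using step_size by (simp add: algebra_simps)
  qed (use W_pos in \<open>auto intro: less_imp_le\<close>)
  then have "gap (x (Suc K)) + c * sqdist (Suc K) \<le> (1 - t) ^ Suc K * (gap (x 0) + c * sqdist 0)"
    using t by (simp add: u_def divide_le_eq mult.commute del: power_Suc)
  moreover have "0 \<le> c * sqdist (Suc K)"
    using t gamma_pos \<mu> by (simp add: c_def sqdist_def)
  ultimately have "gap (x (Suc K)) \<le> (1 - t) ^ Suc K * (gap (x 0) + c * sqdist 0)" by linarith
  then show ?thesis by (simp add: ereal_gap[OF fin] sqdist_def c_def del: power_Suc)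
qed

theorem theorem1:
  fixes f :: "'a::euclidean_space \<Rightarrow> real" and G :: "'a \<Rightarrow> 'a"
    and h F :: "'a \<Rightarrow> ereal" and xs :: 'a
    and x z :: "nat \<Rightarrow> 'a" and \<theta> :: "nat \<Rightarrow> real" and j :: "nat \<Rightarrow> nat"
    and L \<gamma> :: real and \<tau> :: nat
  assumes f_convex: "convex_on UNIV f"
    and f_gradient: "\<And>u. GDERIV f u :> G u"
    and G_lipschitz: "L-lipschitz_on UNIV G"
    and h_proper: "ext_proper h" and h_lsc: "ext_lsc h" and h_convex: "ext_convex h"
    and F_def: "F = (\<lambda>u. ereal (f u) + h u)"
    and xs_min: "is_minimizer F xs"
    and gamma_pos: "\<gamma> > 0"
    and delay: "bounded_delay \<tau> j"
    and iteration: "aagd G h \<gamma> \<theta> j x z"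
  shows
    "(2 * \<gamma> * L + 3 * \<gamma> * L * ((real \<tau>)\<^sup>2 + 3 * real \<tau>)\<^sup>2 \<le> 1 \<and>
      (\<forall>k. \<theta> k = 2 / (real k + 2)) \<and>
      serial_start \<tau> j
      \<longrightarrow> (\<forall>K. F (x (K + 1)) - F xs
             \<le> ereal ((\<theta> K)\<^sup>2 * (1 / (2 * \<gamma>)) * (norm (z 0 - xs))\<^sup>2)))
     \<and>
     (\<forall>\<mu> \<theta>\<^sub>c.
      ext_strongly_convex \<mu> h \<and> 0 < \<mu> \<and> \<mu> \<le> L \<and>
      5 / 2 * \<gamma> * L + \<gamma> * L * ((real \<tau>)\<^sup>2 + 3 * real \<tau>)\<^sup>2 \<le> 1 \<and>
      \<theta>\<^sub>c = (- \<gamma> * \<mu> + sqrt (\<gamma>\<^sup>2 * \<mu>\<^sup>2 + 4 * \<gamma> * \<mu>)) / 2 \<and>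
      (\<forall>k. \<theta> k = \<theta>\<^sub>c)
      \<longrightarrow> (\<forall>K. F (x (K + 1)) - F xs
             \<le> ereal ((1 - \<theta>\<^sub>c) ^ (K + 1)) *
                (F (x 0) - F xs
                  + ereal ((\<theta>\<^sub>c\<^sup>2 / (2 * \<gamma>) + \<mu> * \<theta>\<^sub>c / 2) * (norm (z 0 - xs))\<^sup>2))))"
proof (intro conjI impI allI; elim conjE)
  fix K
  assume "2 * \<gamma> * L + 3 * \<gamma> * L * ((real \<tau>)\<^sup>2 + 3 * real \<tau>)\<^sup>2 \<le> 1"
    and \<theta>: "\<forall>k. \<theta> k = 2 / (real k + 2)" and "serial_start \<tau> j"
  moreover have "aagd_run f G h xs x z \<theta> j L \<gamma> 0 \<tau>"
  \<comment> \<open>Here \<open>aagd_a \<theta> (Suc m) = m / (m + 3)\<close>, which lies in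
    [0, 1].\<close>
  proof
    show "0 \<le> aagd_a \<theta> k \<and> aagd_a \<theta> k \<le> 1" if k: "1 \<le> k" for k
    proof -
      obtain m where "k = Suc m" using k by (cases k) auto
      moreover have "1 - 2 / (real m + 2) = real m / (real m + 2)" by (simp add: field_simps)
      ultimately have "aagd_a \<theta> k = real m / (real m + 3)"
        by (simp add: aagd_a_def \<theta>) (simp add: frac_eq_eq algebra_simps)
      then show ?thesis by simp
    qed
  qed (use assms \<theta> in \<open>simp_all add: ext_strongly_convex_0\<close>)
  ultimately show "F (x (K + 1)) - F xs
      \<le> ereal ((\<theta> K)\<^sup>2 * (1 / (2 * \<gamma>)) * (norm (z 0 - xs))\<^sup>2)"
    using aagd_convex_rate[of f G h xs x z \<theta> j L \<gamma> \<tau> K] by (simp add: F_def)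
next
  fix \<mu> \<theta>\<^sub>c K
  assume sc: "ext_strongly_convex \<mu> h" and \<mu>: "0 < \<mu>" "\<mu> \<le> L"
    and step: "5 / 2 * \<gamma> * L + \<gamma> * L * ((real \<tau>)\<^sup>2 + 3 * real \<tau>)\<^sup>2 \<le> 1"
    and \<theta>\<^sub>c: "\<theta>\<^sub>c = (- \<gamma> * \<mu> + sqrt (\<gamma>\<^sup>2 * \<mu>\<^sup>2 + 4 * \<gamma> * \<mu>)) / 2"
    and \<theta>: "\<forall>k. \<theta> k = \<theta>\<^sub>c"
  have t: "0 < \<theta>\<^sub>c" "\<theta>\<^sub>c < 1" "\<theta>\<^sub>c\<^sup>2 = \<gamma> * \<mu> * (1 - \<theta>\<^sub>c)"
    using strongly_convex_theta[of "\<gamma> * \<mu>" \<theta>\<^sub>c] \<mu> gamma_pos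
    by (simp_all add: \<theta>\<^sub>c power_mult_distrib mult.assoc)
  \<comment> \<open>For constant \<theta>, \<open>aagd_a\<close> is constantly
    \<open>1 - \<theta>\<^sub>c\<close>.\<close>
  have run: "aagd_run f G h xs x z \<theta> j L \<gamma> \<mu> \<tau>"
    by standard (use assms sc \<mu> t \<theta> in \<open>simp_all add: aagd_a_def\<close>)
  show "F (x (K + 1)) - F xs \<le> ereal ((1 - \<theta>\<^sub>c) ^ (K + 1)) *
      (F (x 0) - F xs + ereal ((\<theta>\<^sub>c\<^sup>2 / (2 * \<gamma>) + \<mu> * \<theta>\<^sub>c / 2) * (norm (z 0 - xs))\<^sup>2))"
    using aagd_strongly_convex_rate[OF run \<mu> step _ t(3) t(1,2), of K] \<theta> by (simp add: F_def)
qed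

end
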